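(* Let $\rho\in\mathbb{N}$, and let $\alpha,\beta,\delta_1,\dots,\delta_\rho\in(-1,+\infty)$ and $\kappa_1,\dots,\kappa_\rho\in\mathbb{Z}_+$ be arbitrary parameters. Let $$\mathcal{P}_n(z)={}_{\rho+2}F_{\rho+1}(-n,n+\alpha+\beta+1,\delta_1+1,\dots,\delta_\rho+1;\alpha+1,\kappa_1+\delta_1+1,\dots,\kappa_\rho+\delta_\rho+1;z),$$ $$\mathcal{L}_n(z)={}_{\rho+1}F_{\rho+1}(-n,\delta_1+1,\dots,\delta_\rho+1;\alpha+1,\kappa_1+\delta_1+1,\dots,\kappa_\rho+\delta_\rho+1;z),\qquad n\in\mathbb{Z}_+.$$ Let $\theta=z\frac{d}{dz}$, and define the differential operators $$K=\theta(\theta+\alpha)\prod_{j=1}^\rho(\theta+\kappa_j+\delta_j),\qquad L=\prod_{k=1}^\rho(\theta+\delta_k+1),$$ $$D_0=K-z\theta(\theta+\alpha+\beta+1)L,\qquad D_1=zL,\qquad D_2=K-z\theta L.$$ Then for all $n\in\mathbb{Z}_+$, $$D_0\mathcal{P}_n(z)=-n(n+\alpha+\beta+1)\,D_1\mathcal{P}_n(z),\qquad z\in\mathbb{C},\ |z|<1;$$ $$D_2\mathcal{L}_n(z)=-n\,D_1\mathcal{L}_n(z),\qquad z\in\mathbb{C}.$$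
   Context: $\mathbb{N}$ is the set of positive integers, $\mathbb{Z}_+$ the set of non-negative integers. The Pochhammer symbol is $(c)_0=1$, $(c)_k=c(c+1)\cdots(c+k-1)$ for $k\ge1$. The generalized hypergeometric function is $${}_mF_n(a_1,\dots,a_m;b_1,\dots,b_n;x)=\sum_{k=0}^\infty\frac{(a_1)_k\cdots(a_m)_k}{(b_1)_k\cdots(b_n)_k}\frac{x^k}{k!};$$ when an upper parameter is $-n$ with $n\in\mathbb{Z}_+$ it is a polynomial in $x$ (sum over $0\le k\le n$). Products of operators denote composition, and a factor $z$ on the left denotes multiplication by $z$ applied last. *)

theory Defs
  imports "HOL-Analysis.Analysis"
begin

definition hypergeom :: "complex list \<Rightarrow> complex list \<Rightarrow> complex \<Rightarrow> complex" where
  "hypergeom as bs z = eval_fps (fps_hypergeo as bs 1) z"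

lemma hypergeom_series:
  "hypergeom as bs z =
     (\<Sum>k. (\<Prod>a\<leftarrow>as. pochhammer a k) / (\<Prod>b\<leftarrow>bs. pochhammer b k) * (z ^ k / fact k))"
proof -
  have *: "foldr (\<lambda>a r. r * pochhammer a k) cs x = (\<Prod>c\<leftarrow>cs. pochhammer c k) * x"
    for cs :: "complex list" and x k
    by (induction cs) (simp_all add: mult_ac)
  show ?thesis
    unfolding hypergeom_def eval_fps_def fps_hypergeo_nth_alt *
    by simp
qed

definition PP :: "nat \<Rightarrow> real \<Rightarrow> real \<Rightarrow> (nat \<Rightarrow> real) \<Rightarrow> (nat \<Rightarrow> nat) \<Rightarrow> nat \<Rightarrow> complex \<Rightarrow> complex" where
  "PP \<rho> \<alpha> \<beta> \<delta> \<kappa> n =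
     hypergeom
       ([- of_nat n, of_nat n + of_real \<alpha> + of_real \<beta> + 1] @
          map (\<lambda>j. of_real (\<delta> j) + 1) [1..<Suc \<rho>])
       ((of_real \<alpha> + 1) #
          map (\<lambda>j. of_nat (\<kappa> j) + of_real (\<delta> j) + 1) [1..<Suc \<rho>])"

definition LL :: "nat \<Rightarrow> real \<Rightarrow> (nat \<Rightarrow> real) \<Rightarrow> (nat \<Rightarrow> nat) \<Rightarrow> nat \<Rightarrow> complex \<Rightarrow> complex" where
  "LL \<rho> \<alpha> \<delta> \<kappa> n =
     hypergeom
       ((- of_nat n) # map (\<lambda>j. of_real (\<delta> j) + 1) [1..<Suc \<rho>])
       ((of_real \<alpha> + 1) #
          map (\<lambda>j. of_nat (\<kappa> j) + of_real (\<delta> j) + 1) [1..<Suc \<rho>])"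

type_synonym oper = "(complex \<Rightarrow> complex) \<Rightarrow> (complex \<Rightarrow> complex)"

definition theta :: oper where
  "theta f = (\<lambda>z. z * deriv f z)"

definition theta_plus :: "real \<Rightarrow> oper" where
  "theta_plus c f = (\<lambda>z. theta f z + of_real c * f z)"

definition mult_z :: oper where
  "mult_z f = (\<lambda>z. z * f z)"

(* The factors (theta + c) commute on smooth functions, but not on arbitrary functions, where deriv
   is unspecified; so the products are fixed as compositions with the leftmost factor applied last. *)
definition oper_prod :: "oper list \<Rightarrow> oper" where
  "oper_prod Ts = foldr (\<circ>) Ts id"

definition K_op :: "nat \<Rightarrow> real \<Rightarrow> (nat \<Rightarrow> real) \<Rightarrow> (nat \<Rightarrow> nat) \<Rightarrow> oper" where
  "K_op \<rho> \<alpha> \<delta> \<kappa> =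
     theta \<circ> theta_plus \<alpha> \<circ>
       oper_prod (map (\<lambda>j. theta_plus (real (\<kappa> j) + \<delta> j)) [1..<Suc \<rho>])"

definition L_op :: "nat \<Rightarrow> (nat \<Rightarrow> real) \<Rightarrow> oper" where
  "L_op \<rho> \<delta> = oper_prod (map (\<lambda>k. theta_plus (\<delta> k + 1)) [1..<Suc \<rho>])"

definition D0 :: "nat \<Rightarrow> real \<Rightarrow> real \<Rightarrow> (nat \<Rightarrow> real) \<Rightarrow> (nat \<Rightarrow> nat) \<Rightarrow> oper" where
  "D0 \<rho> \<alpha> \<beta> \<delta> \<kappa> f =
     (\<lambda>z. K_op \<rho> \<alpha> \<delta> \<kappa> f z - (mult_z \<circ> theta \<circ> theta_plus (\<alpha> + \<beta> + 1) \<circ> L_op \<rho> \<delta>) f z)"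

definition D1 :: "nat \<Rightarrow> (nat \<Rightarrow> real) \<Rightarrow> oper" where
  "D1 \<rho> \<delta> = mult_z \<circ> L_op \<rho> \<delta>"

definition D2 :: "nat \<Rightarrow> real \<Rightarrow> (nat \<Rightarrow> real) \<Rightarrow> (nat \<Rightarrow> nat) \<Rightarrow> oper" where
  "D2 \<rho> \<alpha> \<delta> \<kappa> f =
     (\<lambda>z. K_op \<rho> \<alpha> \<delta> \<kappa> f z - (mult_z \<circ> theta \<circ> L_op \<rho> \<delta>) f z)"

end

theory Submission
  imports Defs
begin

text \<open>On a polynomial with coefficients \<open>c k\<close>, the operator \<open>theta_plus s\<close> acts diagonally, multiplying
  \<open>c k\<close> by \<open>k + s\<close>. Both differential equations therefore reduce to the first-order recurrence
  \<open>c (k + 1) (k + 1) \<Prod>\<^sub>b (b + k) = c k \<Prod>\<^sub>a (a + k)\<close> of the hypergeometric coefficients, together with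
  \<open>k (k + s) - n (n + s) = (k - n) (k + n + s)\<close> for \<open>D0\<close>. The series stops at \<open>k = n\<close>, where the factor
  \<open>k - n\<close> vanishes.\<close>

definition poly_fun :: "nat \<Rightarrow> (nat \<Rightarrow> complex) \<Rightarrow> complex \<Rightarrow> complex" where
  "poly_fun N c = (\<lambda>z. \<Sum>k\<le>N. c k * z ^ k)"

lemma poly_fun_cmult: "a * poly_fun N c z = poly_fun N (\<lambda>k. a * c k) z"
  by (simp add: poly_fun_def sum_distrib_left mult.assoc)

lemma poly_fun_diff: "poly_fun N c z - poly_fun N d z = poly_fun N (\<lambda>k. c k - d k) z"
  by (simp add: poly_fun_def sum_subtractf left_diff_distrib)

text \<open>An equality of functions, not only of values at one point: compositions differentiate
  the result again. The bound \<open>N\<close> is preserved, so iterates can be compared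
  coefficientwise.\<close>

lemma theta_poly_fun: "theta (poly_fun N c) = poly_fun N (\<lambda>k. of_nat k * c k)"
proof
  fix z
  have "(poly_fun N c has_field_derivative (\<Sum>k\<le>N. c k * (of_nat k * z ^ (k - 1)))) (at z)"
    unfolding poly_fun_def by (auto intro!: derivative_eq_intros sum.cong)
  then have "theta (poly_fun N c) z = z * (\<Sum>k\<le>N. c k * (of_nat k * z ^ (k - 1)))"
    unfolding theta_def by (simp add: DERIV_imp_deriv)
  also have "\<dots> = poly_fun N (\<lambda>k. of_nat k * c k) z"
    unfolding poly_fun_def sum_distrib_left
  proof (rule sum.cong[OF refl])
    fix k
    show "z * (c k * (of_nat k * z ^ (k - 1))) = of_nat k * c k * z ^ k"
      \<comment> \<open>For \<open>k = 0\<close> the exponent \<open>k - 1\<close> truncates to 0,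
        and the factor \<open>of_nat k\<close> kills the term.\<close>
      by (cases k) simp_all
  qed
  finally show "theta (poly_fun N c) z = poly_fun N (\<lambda>k. of_nat k * c k) z" .
qed

lemma theta_plus_poly_fun:
  "theta_plus s (poly_fun N c) = poly_fun N (\<lambda>k. (of_nat k + of_real s) * c k)"
  unfolding theta_plus_def theta_poly_fun
  by (simp add: poly_fun_def sum_distrib_left sum.distrib[symmetric] algebra_simps)

lemma oper_prod_theta_plus_poly_fun:
  "oper_prod (map (\<lambda>j. theta_plus (s j)) js) (poly_fun N c) =
     poly_fun N (\<lambda>k. (\<Prod>j\<leftarrow>js. of_nat k + of_real (s j)) * c k)"
  by (induction js) (simp_all add: oper_prod_def theta_plus_poly_fun mult.assoc)

definition hypergeom_coeff :: "complex list \<Rightarrow> complex list \<Rightarrow> nat \<Rightarrow> complex" where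
  "hypergeom_coeff as bs k =
     (\<Prod>a\<leftarrow>as. pochhammer a k) / ((\<Prod>b\<leftarrow>bs. pochhammer b k) * fact k)"

text \<open>The Pochhammer symbol of \<open>- of_nat n\<close> vanishes beyond index
  \<open>n\<close>, so the coefficients are 0 there whatever the denominators are.\<close>

lemma hypergeom_terminating:
  "hypergeom (- of_nat n # as) bs = poly_fun n (hypergeom_coeff (- of_nat n # as) bs)"
proof
  fix z
  have "hypergeom (- of_nat n # as) bs z =
          (\<Sum>k. hypergeom_coeff (- of_nat n # as) bs k * z ^ k)"
    by (simp add: hypergeom_series hypergeom_coeff_def)
  also have "\<dots> = (\<Sum>k\<le>n. hypergeom_coeff (- of_nat n # as) bs k * z ^ k)"
    by (rule suminf_finite) (auto simp: hypergeom_coeff_def pochhammer_of_nat_eq_0_iff)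
  finally show "hypergeom (- of_nat n # as) bs z =
      poly_fun n (hypergeom_coeff (- of_nat n # as) bs) z"
    by (simp add: poly_fun_def)
qed

lemma prod_list_pochhammer_Suc:
  "(\<Prod>a\<leftarrow>as. pochhammer a (Suc k)) =
     (\<Prod>a\<leftarrow>as. pochhammer a k) * (\<Prod>a\<leftarrow>as. a + of_nat k :: 'a :: comm_semiring_1)"
  by (induction as) (simp_all add: pochhammer_Suc mult_ac)

text \<open>Passing from \<open>k\<close> to \<open>k + 1\<close> introduces only the factors
  \<open>a + k\<close>, \<open>b + k\<close> and \<open>k + 1\<close>, so nonvanishing is required
  at this \<open>k\<close> alone. If some \<open>pochhammer b k\<close> is 0, both coefficients are
  0 by the convention for division by zero.\<close>

lemma hypergeom_coeff_Suc:
  assumes "\<And>b. b \<in> set bs \<Longrightarrow> b + of_nat k \<noteq> 0"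
  shows "of_nat (Suc k) * (\<Prod>b\<leftarrow>bs. b + of_nat k) * hypergeom_coeff as bs (Suc k) =
           (\<Prod>a\<leftarrow>as. a + of_nat k) * hypergeom_coeff as bs k"
proof -
  have "(\<Prod>b\<leftarrow>bs. b + of_nat k) \<noteq> 0"
    using assms by (auto simp: prod_list_zero_iff)
  moreover have "(of_nat (Suc k) :: complex) \<noteq> 0"
    by (rule of_nat_neq_0)
  ultimately show ?thesis
    unfolding hypergeom_coeff_def prod_list_pochhammer_Suc fact_Suc
    by (simp add: divide_simps del: of_nat_Suc)
qed

text \<open>This is the classical hypergeometric equation, with \<open>theta\<close> times all
  \<open>theta + b - 1\<close> on the left and \<open>z\<close> times all \<open>theta + a\<close>
  on the right, in terms of coefficients. The parameter \<open>- of_nat n\<close> contributes the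
  factor \<open>k - n\<close>.\<close>

lemma hypergeom_terminating_ode:
  fixes as bs :: "complex list" and n :: nat
  assumes nz: "\<And>b k. b \<in> set bs \<Longrightarrow> b + of_nat k \<noteq> 0"
  defines "c \<equiv> hypergeom_coeff (- of_nat n # as) bs"
  shows "poly_fun n (\<lambda>k. of_nat k * (\<Prod>b\<leftarrow>bs. b + of_nat k - 1) * c k) z =
           z * poly_fun n (\<lambda>k. (of_nat k - of_nat n) * (\<Prod>a\<leftarrow>as. a + of_nat k) * c k) z"
proof -
  have step: "of_nat (Suc k) * (\<Prod>b\<leftarrow>bs. b + of_nat (Suc k) - 1) * c (Suc k) =
          (of_nat k - of_nat n) * (\<Prod>a\<leftarrow>as. a + of_nat k) * c k" for k
    using hypergeom_coeff_Suc[of bs k "- of_nat n # as"] nz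
    unfolding c_def by (simp add: algebra_simps)
  \<comment> \<open>The constant term vanishes through the factor \<open>of_nat k\<close>; the
    remaining indices are shifted down by one.\<close>
  have "poly_fun n (\<lambda>k. of_nat k * (\<Prod>b\<leftarrow>bs. b + of_nat k - 1) * c k) z =
          (\<Sum>k<n. (of_nat k - of_nat n) * (\<Prod>a\<leftarrow>as. a + of_nat k) * c k * z ^ Suc k)"
    unfolding poly_fun_def lessThan_Suc_atMost[symmetric] sum.lessThan_Suc_shift step by simp
  \<comment> \<open>The term \<open>k = n\<close> may be added, since its factor
    \<open>k - n\<close> is 0.\<close>
  also have "\<dots> = z * poly_fun n (\<lambda>k. (of_nat k - of_nat n) * (\<Prod>a\<leftarrow>as. a + of_nat k) * c k) z"
    unfolding poly_fun_def lessThan_Suc_atMost[symmetric] sum.lessThan_Suc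
    by (simp add: sum_distrib_left mult_ac)
  finally show ?thesis .
qed

theorem proposition2:
  fixes \<rho> :: nat and \<alpha> \<beta> :: real and \<delta> :: "nat \<Rightarrow> real" and \<kappa> :: "nat \<Rightarrow> nat"
  assumes "\<rho> \<ge> 1"
    and "\<alpha> > -1" and "\<beta> > -1"
    and "\<And>j. j \<in> {1..\<rho>} \<Longrightarrow> \<delta> j > -1"
  shows "\<forall>n :: nat.
      (\<forall>z :: complex. norm z < 1 \<longrightarrow>
         D0 \<rho> \<alpha> \<beta> \<delta> \<kappa> (PP \<rho> \<alpha> \<beta> \<delta> \<kappa> n) z
           = - of_nat n * (of_nat n + of_real \<alpha> + of_real \<beta> + 1)
               * D1 \<rho> \<delta> (PP \<rho> \<alpha> \<beta> \<delta> \<kappa> n) z)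
    \<and> (\<forall>z :: complex.
         D2 \<rho> \<alpha> \<delta> \<kappa> (LL \<rho> \<alpha> \<delta> \<kappa> n) z
           = - of_nat n * D1 \<rho> \<delta> (LL \<rho> \<alpha> \<delta> \<kappa> n) z)"
proof (intro allI conjI impI)
  fix n :: nat and z :: complex
  define as where "as = map (\<lambda>j. of_real (\<delta> j) + 1 :: complex) [1..<Suc \<rho>]"
  define bs where
    "bs = (of_real \<alpha> + 1 :: complex) # map (\<lambda>j. of_nat (\<kappa> j) + of_real (\<delta> j) + 1) [1..<Suc \<rho>]"
  \<comment> \<open>\<open>P k\<close> is the eigenvalue of \<open>L_op\<close> on the monomial of
    degree \<open>k\<close>.\<close>
  define P where "P k = (\<Prod>j\<leftarrow>[1..<Suc \<rho>]. of_nat k + of_real (\<delta> j + 1) :: complex)" for k :: nat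
  have P_eq: "(\<Prod>a\<leftarrow>as. a + of_nat k) = P k" for k
    by (simp add: as_def P_def o_def add_ac del: upt_Suc)
  have nz: "b + of_nat k \<noteq> 0" if "b \<in> set bs" for b k
  proof -
    have "Re b > 0"
      using that assms by (fastforce simp: bs_def simp del: upt_Suc)
    then have "Re (b + of_nat k) > 0"
      by simp
    then show ?thesis
      by (metis less_irrefl zero_complex.sel(1))
  qed
  \<comment> \<open>Subtracting 1 from the lower parameters gives exactly the shifts \<alpha> and
    \<open>\<kappa> j + \<delta> j\<close> in \<open>K_op\<close>.\<close>
  have K: "K_op \<rho> \<alpha> \<delta> \<kappa> (poly_fun n c) =
      poly_fun n (\<lambda>k. of_nat k * (\<Prod>b\<leftarrow>bs. b + of_nat k - 1) * c k)" for c
    by (simp add: K_op_def oper_prod_theta_plus_poly_fun theta_plus_poly_fun theta_poly_fun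
        bs_def o_def algebra_simps del: upt_Suc)
  have L: "L_op \<rho> \<delta> (poly_fun n c) = poly_fun n (\<lambda>k. P k * c k)" for c
    unfolding L_op_def oper_prod_theta_plus_poly_fun P_def ..
  {
    define A where "A = (of_nat n + of_real \<alpha> + of_real \<beta> + 1 :: complex)"
    define c where "c = hypergeom_coeff (- of_nat n # A # as) bs"
    have PP: "PP \<rho> \<alpha> \<beta> \<delta> \<kappa> n = poly_fun n c"
      unfolding c_def hypergeom_terminating[symmetric]
      by (simp add: PP_def as_def bs_def A_def del: upt_Suc)
    have "K_op \<rho> \<alpha> \<delta> \<kappa> (poly_fun n c) z =
        z * poly_fun n (\<lambda>k. (of_nat k - of_nat n) * (A + of_nat k) * P k * c k) z"
      using hypergeom_terminating_ode[of bs n "A # as" z] nz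
      by (simp add: K c_def P_eq mult.assoc)
    \<comment> \<open>With \<open>s = \<alpha> + \<beta> + 1\<close> and \<open>A = n + s\<close>,
      each coefficient uses \<open>(k - n) * (A + k) - k * (k + s) = - n * A\<close>, which is
      independent of \<open>k\<close>.\<close>
    moreover have "poly_fun n (\<lambda>k. (of_nat k - of_nat n) * (A + of_nat k) * P k * c k) z -
        poly_fun n (\<lambda>k. of_nat k * ((of_nat k + of_real (\<alpha> + \<beta> + 1)) * (P k * c k))) z =
        - of_nat n * A * poly_fun n (\<lambda>k. P k * c k) z"
      unfolding poly_fun_diff poly_fun_cmult A_def by (simp add: algebra_simps)
    ultimately show "D0 \<rho> \<alpha> \<beta> \<delta> \<kappa> (PP \<rho> \<alpha> \<beta> \<delta> \<kappa> n) z =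
        - of_nat n * (of_nat n + of_real \<alpha> + of_real \<beta> + 1)
          * D1 \<rho> \<delta> (PP \<rho> \<alpha> \<beta> \<delta> \<kappa> n) z"
      unfolding PP D0_def D1_def o_apply L theta_plus_poly_fun theta_poly_fun mult_z_def
      by (simp add: A_def mult.left_commute flip: right_diff_distrib)
  }
  {
    define c where "c = hypergeom_coeff (- of_nat n # as) bs"
    have LL: "LL \<rho> \<alpha> \<delta> \<kappa> n = poly_fun n c"
      unfolding c_def hypergeom_terminating[symmetric]
      by (simp add: LL_def as_def bs_def del: upt_Suc)
    have "K_op \<rho> \<alpha> \<delta> \<kappa> (poly_fun n c) z =
        z * poly_fun n (\<lambda>k. (of_nat k - of_nat n) * P k * c k) z"
      using hypergeom_terminating_ode[of bs n as z] nz by (simp add: K c_def P_eq)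
    \<comment> \<open>Without the parameter \<open>A\<close> the eigenvalue identity is just
      \<open>(k - n) - k = - n\<close>.\<close>
    moreover have "poly_fun n (\<lambda>k. (of_nat k - of_nat n) * P k * c k) z -
        poly_fun n (\<lambda>k. of_nat k * (P k * c k)) z =
        - of_nat n * poly_fun n (\<lambda>k. P k * c k) z"
      unfolding poly_fun_diff poly_fun_cmult by (simp add: algebra_simps)
    ultimately show "D2 \<rho> \<alpha> \<delta> \<kappa> (LL \<rho> \<alpha> \<delta> \<kappa> n) z =
        - of_nat n * D1 \<rho> \<delta> (LL \<rho> \<alpha> \<delta> \<kappa> n) z"
      unfolding LL D2_def D1_def o_apply L theta_poly_fun mult_z_def
      by (simp add: mult.left_commute flip: right_diff_distrib)
  }
qed

end
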